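(* Let $\lambda\ge\omega$ be a regular cardinal, $U$ a uniform $\lambda$-complete ultrafilter on $\lambda$, and for each $\alpha<\lambda$ let $V_\alpha$ be a uniform $\delta_\alpha$-complete ultrafilter on a regular cardinal $\delta_\alpha\ge\omega$. Let $\mathbb{P}$ be a complete partial order. Then $\mathbb{P}$ is uniformly below $\mathcal{B}(U,\langle V_\alpha:\alpha<\lambda\rangle)$ if and only if $\sum_U V_\alpha\ge_T\mathbb{P}$.
   Context: A filter on a regular cardinal $\kappa$ is uniform if it contains all sets with bounded complement. $\sum_U V_\alpha$ is the ultrafilter on $\bigcup_{\alpha<\lambda}\{\alpha\}\times\delta_\alpha$ given by $A\in\sum_UV_\alpha$ iff $\{\alpha<\lambda:(A)_\alpha\in V_\alpha\}\in U$, where $(A)_\alpha=\{y:(\alpha,y)\in A\}$; filters are ordered by reverse inclusion. For $X\in U$ let $U\times\prod_{\alpha\in X}V_\alpha$ be the set of pairs $\langle Z,\langle A_\alpha:\alpha\in X\rangle\rangle$ with $Z\in U$, $A_\alpha\in V_\alpha$, ordered coordinatewise by reverse inclusion; $\mathcal{B}(U,\langle V_\alpha\rangle)=\{U\times\prod_{\alpha\in X}V_\alpha: X\in U\}$. For $Y\subseteq X$ in $U$, $\pi_{X,Y}(\langle Z,\langle A_\alpha:\alpha\in X\rangle\rangle)=\langle Z,\langle A_\alpha:\alpha\in Y\rangle\rangle$. A partial order is complete if every subset with an upper bound has a least upper bound. A map between posets is monotone if order preserving, and cofinal if its image is cofinal. A sequence $\langle f_X:U\times\prod_{\alpha\in X}V_\alpha\to\mathbb{P}\mid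 X\in U\rangle$ of monotone cofinal maps is coherent if whenever $Y\subseteq X$ are in $U$ and $C\in U\times\prod_{\alpha\in X}V_\alpha$, $f_Y(\pi_{X,Y}(C))\ge_{\mathbb{P}}f_X(C)$. $\mathbb{P}$ is uniformly below $\mathcal{B}(U,\langle V_\alpha\rangle)$ if such a coherent sequence exists. $Q\ge_T\mathbb{P}$ (Tukey) means there is a map $Q\to\mathbb{P}$ sending cofinal subsets to cofinal subsets. *)

theory Defs
  imports "HOL-Library.FuncSet"
begin

unbundle cardinal_syntax

text \<open>
  Cardinals are well-orders \<open>r\<close> with \<open>Card_order r\<close>, the cardinal as a set of ordinals being
  \<open>Field r\<close>. Posets are relations as well, with \<open>(x, y) \<in> P\<close> read as \<open>x \<le> y\<close> and carrier
  \<open>Field P\<close>. The strict \<^const>\<open>cofinal\<close> of the library is only adequate for orders without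
  maximal elements, hence \<open>cofinal_in\<close> below.
\<close>

definition infinite_regular_cardinal :: "'a rel \<Rightarrow> bool" where
  "infinite_regular_cardinal r \<longleftrightarrow> Cinfinite r \<and> regularCard r"

definition filter_on :: "'a set \<Rightarrow> 'a set set \<Rightarrow> bool" where
  "filter_on X F \<longleftrightarrow> F \<subseteq> Pow X \<and> X \<in> F \<and> {} \<notin> F \<and>
     (\<forall>A\<in>F. \<forall>B\<in>F. A \<inter> B \<in> F) \<and> (\<forall>A\<in>F. \<forall>B. A \<subseteq> B \<and> B \<subseteq> X \<longrightarrow> B \<in> F)"

definition ultrafilter_on :: "'a set \<Rightarrow> 'a set set \<Rightarrow> bool" where
  "ultrafilter_on X F \<longleftrightarrow> filter_on X F \<and> (\<forall>A. A \<subseteq> X \<longrightarrow> A \<in> F \<or> X - A \<in> F)"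

definition uniform_filter :: "'a rel \<Rightarrow> 'a set set \<Rightarrow> bool" where
  "uniform_filter r F \<longleftrightarrow> (\<forall>A. A \<subseteq> Field r \<and> Above r (Field r - A) \<noteq> {} \<longrightarrow> A \<in> F)"

text \<open>Closure under intersections of fewer than \<open>r\<close> many members, \<open>r\<close> being a cardinal.\<close>

definition complete_filter :: "'k rel \<Rightarrow> 'a set set \<Rightarrow> bool" where
  "complete_filter r F \<longleftrightarrow> (\<forall>\<A>. \<A> \<subseteq> F \<and> \<A> \<noteq> {} \<and> |\<A>| <o r \<longrightarrow> \<Inter>\<A> \<in> F)"

definition uniform_complete_ultrafilter :: "'a rel \<Rightarrow> 'a set set \<Rightarrow> bool" where
  "uniform_complete_ultrafilter r F \<longleftrightarrow>
     ultrafilter_on (Field r) F \<and> uniform_filter r F \<and> complete_filter r F"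

definition sum_ultrafilter ::
  "'a rel \<Rightarrow> ('a \<Rightarrow> 'b rel) \<Rightarrow> 'a set set \<Rightarrow> ('a \<Rightarrow> 'b set set) \<Rightarrow> ('a \<times> 'b) set set" where
  "sum_ultrafilter l d U V =
     {A. A \<subseteq> (SIGMA \<alpha>:Field l. Field (d \<alpha>)) \<and> {\<alpha> \<in> Field l. A `` {\<alpha>} \<in> V \<alpha>} \<in> U}"

definition reverse_inclusion :: "'a set set \<Rightarrow> 'a set rel" where
  "reverse_inclusion F = {(A, B). A \<in> F \<and> B \<in> F \<and> B \<subseteq> A}"

definition complete_order :: "'p rel \<Rightarrow> bool" where
  "complete_order P \<longleftrightarrow>
     (\<forall>S. S \<subseteq> Field P \<and> Above P S \<noteq> {} \<longrightarrow> (\<exists>s\<in>Above P S. \<forall>b\<in>Above P S. (s, b) \<in> P))"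

definition cofinal_in :: "'p rel \<Rightarrow> 'p set \<Rightarrow> bool" where
  "cofinal_in P C \<longleftrightarrow> C \<subseteq> Field P \<and> (\<forall>x\<in>Field P. \<exists>y\<in>C. (x, y) \<in> P)"

definition tukey_ge :: "'q rel \<Rightarrow> 'p rel \<Rightarrow> bool" where
  "tukey_ge Q P \<longleftrightarrow>
     (\<exists>f. f \<in> Field Q \<rightarrow> Field P \<and> (\<forall>C. cofinal_in Q C \<longrightarrow> cofinal_in P (f ` C)))"

definition monotone_cofinal_map :: "'q rel \<Rightarrow> 'p rel \<Rightarrow> ('q \<Rightarrow> 'p) \<Rightarrow> bool" where
  "monotone_cofinal_map Q P f \<longleftrightarrow>
     f \<in> Field Q \<rightarrow> Field P \<and>
     monotone_on (Field Q) (\<lambda>x y. (x, y) \<in> Q) (\<lambda>x y. (x, y) \<in> P) f \<and>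
     cofinal_in P (f ` Field Q)"

text \<open>
  \<open>prod_order U V X\<close> is the poset \<open>U \<times> \<Prod>\<^bsub>\<alpha>\<in>X\<^esub> V\<^sub>\<alpha>\<close>. Sequences indexed by \<open>X\<close> are extensional
  functions, so that they are determined by their values on \<open>X\<close>.
\<close>

definition prod_order ::
  "'a set set \<Rightarrow> ('a \<Rightarrow> 'b set set) \<Rightarrow> 'a set \<Rightarrow> ('a set \<times> ('a \<Rightarrow> 'b set)) rel" where
  "prod_order U V X =
     {((Z, A), (Z', A')). Z \<in> U \<and> Z' \<in> U \<and> A \<in> Pi\<^sub>E X V \<and> A' \<in> Pi\<^sub>E X V \<and>
        Z' \<subseteq> Z \<and> (\<forall>\<alpha>\<in>X. A' \<alpha> \<subseteq> A \<alpha>)}"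

text \<open>The projection \<open>\<pi>\<^bsub>X,Y\<^esub>\<close>; its value does not depend on \<open>X\<close>.\<close>

definition prod_proj :: "'a set \<Rightarrow> 'a set \<times> ('a \<Rightarrow> 'b set) \<Rightarrow> 'a set \<times> ('a \<Rightarrow> 'b set)" where
  "prod_proj Y = (\<lambda>(Z, A). (Z, restrict A Y))"

definition coherent_sequence ::
  "'a set set \<Rightarrow> ('a \<Rightarrow> 'b set set) \<Rightarrow> 'p rel
     \<Rightarrow> ('a set \<Rightarrow> 'a set \<times> ('a \<Rightarrow> 'b set) \<Rightarrow> 'p) \<Rightarrow> bool" where
  "coherent_sequence U V P f \<longleftrightarrow>
     (\<forall>X\<in>U. monotone_cofinal_map (prod_order U V X) P (f X)) \<and>
     (\<forall>X\<in>U. \<forall>Y\<in>U. Y \<subseteq> X \<longrightarrow>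
        (\<forall>C\<in>Field (prod_order U V X). (f X C, f Y (prod_proj Y C)) \<in> P))"

text \<open>
  \<open>P\<close> is uniformly below \<open>\<B>(U, \<langle>V\<^sub>\<alpha>\<rangle>)\<close>. The family \<open>\<B>(U, \<langle>V\<^sub>\<alpha>\<rangle>)\<close>, that is
  \<open>prod_order U V X\<close> for \<open>X \<in> U\<close>, enters through the parameters \<open>U\<close> and \<open>V\<close>.
\<close>

definition uniformly_below :: "'p rel \<Rightarrow> 'a set set \<Rightarrow> ('a \<Rightarrow> 'b set set) \<Rightarrow> bool" where
  "uniformly_below P U V \<longleftrightarrow> (\<exists>f. coherent_sequence U V P f)"

end

theory Submission
  imports Defs
begin

text \<open>
  For a complete order \<open>P\<close>, the Tukey relation \<open>Q \<ge>\<^sub>T P\<close> is witnessed by a monotone cofinal map: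
  if \<open>h\<close> sends cofinal sets to cofinal sets, then \<open>q \<mapsto> inf {h q' | q' \<ge> q}\<close> is such a map.
  From a monotone cofinal \<open>g\<close> on the sum one obtains the coherent sequence
  \<open>f\<^sub>X (Z, A) = g (\<Union>\<^bsub>\<alpha> \<in> Z \<inter> X\<^esub> {\<alpha>} \<times> A\<^sub>\<alpha>)\<close>. Conversely, with \<open>X\<^sub>B = {\<alpha>. (B)\<^sub>\<alpha> \<in> V\<^sub>\<alpha>}\<close>, a coherent
  sequence gives \<open>g B = f\<^bsub>X\<^sub>B\<^esub> (X\<^sub>B, (B)\<^sub>\<alpha>)\<close>, and coherence makes \<open>g\<close> monotone and cofinal.
\<close>

section \<open>Carriers, bounds and order-preserving maps\<close>

lemma Field_reverse_inclusion [simp]: "Field (reverse_inclusion F) = F"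
  by (auto simp: reverse_inclusion_def Field_def)

lemma Field_prod_order [simp]: "Field (prod_order U V X) = U \<times> Pi\<^sub>E X V"
  by (auto simp: prod_order_def Field_def)

lemma mem_Above_iff: "x \<in> Above r S \<longleftrightarrow> x \<in> Field r \<and> (\<forall>s\<in>S. (s, x) \<in> r)"
  by (auto simp: Above_def)

lemma partial_order_refl: "Partial_order r \<Longrightarrow> x \<in> Field r \<Longrightarrow> (x, x) \<in> r"
  by (auto simp: partial_order_on_def preorder_on_def refl_on_def)

lemma partial_order_trans: "Partial_order r \<Longrightarrow> (x, y) \<in> r \<Longrightarrow> (y, z) \<in> r \<Longrightarrow> (x, z) \<in> r"
  unfolding partial_order_on_def preorder_on_def by (meson transD)

lemma monotone_cofinal_mapD:
  assumes "monotone_cofinal_map Q P f"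
  shows "x \<in> Field Q \<Longrightarrow> f x \<in> Field P"
    and "(x, y) \<in> Q \<Longrightarrow> (f x, f y) \<in> P"
    and "p \<in> Field P \<Longrightarrow> \<exists>x\<in>Field Q. (p, f x) \<in> P"
  using assms FieldI1[of x y Q] FieldI2[of x y Q]
  by (auto simp: monotone_cofinal_map_def cofinal_in_def dest: monotone_onD)

lemma coherent_sequenceD:
  assumes "coherent_sequence U V P f"
  shows "X \<in> U \<Longrightarrow> monotone_cofinal_map (prod_order U V X) P (f X)"
    and "X \<in> U \<Longrightarrow> Y \<in> U \<Longrightarrow> Y \<subseteq> X \<Longrightarrow> C \<in> Field (prod_order U V X) \<Longrightarrow>
      (f X C, f Y (prod_proj Y C)) \<in> P"
  using assms unfolding coherent_sequence_def by blast+

section \<open>Tukey reductions and monotone cofinal maps\<close>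

lemma tukey_ge_if_monotone_cofinal_map:
  assumes "Partial_order P" and f: "monotone_cofinal_map Q P f"
  shows "tukey_ge Q P"
  unfolding tukey_ge_def
proof (intro exI conjI allI impI)
  show closed: "f \<in> Field Q \<rightarrow> Field P"
    using monotone_cofinal_mapD(1)[OF f] by auto
  fix C assume C: "cofinal_in Q C"
  show "cofinal_in P (f ` C)"
    unfolding cofinal_in_def
  proof (intro conjI ballI)
    show "f ` C \<subseteq> Field P"
      using closed C by (auto simp: cofinal_in_def)
    fix p assume "p \<in> Field P"
    then obtain q where q: "q \<in> Field Q" "(p, f q) \<in> P"
      using monotone_cofinal_mapD(3)[OF f] by blast
    then obtain c where c: "c \<in> C" "(q, c) \<in> Q"
      using C by (auto simp: cofinal_in_def)
    have "(f q, f c) \<in> P"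
      by (rule monotone_cofinal_mapD(2)[OF f c(2)])
    then show "\<exists>y\<in>f ` C. (p, y) \<in> P"
      using partial_order_trans[OF assms(1)] q c by blast
  qed
qed

text \<open>By contraposition: the elements that \<open>h\<close> does not send above
  \<open>p\<close> form a set whose image misses everything above \<open>p\<close>. That image is
  not cofinal, so the set is not cofinal either, and any \<open>q\<close> witnessing this has no
  member of the set above it. In other words, \<open>h\<close> is eventually above every
  \<open>p\<close>.\<close>

lemma tukey_ge_obtain_bound:
  assumes "Partial_order P"
    and h: "\<And>C. cofinal_in Q C \<Longrightarrow> cofinal_in P (h ` C)"
    and p: "p \<in> Field P"
  obtains q where "q \<in> Field Q" "\<And>q'. (q, q') \<in> Q \<Longrightarrow> (p, h q') \<in> P"
proof -
  let ?C = "{q' \<in> Field Q. (p, h q') \<notin> P}"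
  have "\<not> cofinal_in P (h ` ?C)"
    using p by (auto simp: cofinal_in_def)
  then have "\<not> cofinal_in Q ?C"
    using h by blast
  then obtain q where "q \<in> Field Q" "\<And>q'. q' \<in> ?C \<Longrightarrow> (q, q') \<notin> Q"
    by (auto simp: cofinal_in_def)
  then show thesis
    by (intro that[of q]) (auto intro: FieldI2)
qed

lemma monotone_cofinal_map_if_tukey_ge:
  assumes Q: "Partial_order Q" and P: "Partial_order P" "complete_order P"
    and "tukey_ge Q P"
  obtains g where "monotone_cofinal_map Q P g"
proof -
  obtain h where h: "h \<in> Field Q \<rightarrow> Field P"
    and cofinal: "\<And>C. cofinal_in Q C \<Longrightarrow> cofinal_in P (h ` C)"
    using assms(4) by (auto simp: tukey_ge_def)
  \<comment> \<open>Completeness provides suprema only, so the infimum of the values of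
    \<open>h\<close> above \<open>q\<close> is formed as the supremum of the set \<open>S q\<close>
    of their lower bounds. This supremum exists because \<open>h q\<close> is itself one of these
    values and thus bounds \<open>S q\<close>.\<close>
  define S where "S q = {p \<in> Field P. \<forall>q'. (q, q') \<in> Q \<longrightarrow> (p, h q') \<in> P}" for q
  have "\<exists>s\<in>Above P (S q). \<forall>b\<in>Above P (S q). (s, b) \<in> P" if "q \<in> Field Q" for q
  proof -
    have "h q \<in> Above P (S q)"
      using that h partial_order_refl[OF Q that] by (auto simp: S_def mem_Above_iff)
    moreover have "S q \<subseteq> Field P"
      by (auto simp: S_def)
    ultimately show ?thesis
      using P(2) unfolding complete_order_def by blast
  qed
  then obtain g where g: "\<And>q. q \<in> Field Q \<Longrightarrow> g q \<in> Above P (S q)"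
    and least: "\<And>q b. q \<in> Field Q \<Longrightarrow> b \<in> Above P (S q) \<Longrightarrow> (g q, b) \<in> P"
    by metis
  have "monotone_cofinal_map Q P g"
    unfolding monotone_cofinal_map_def
  proof (intro conjI monotone_onI)
    show closed: "g \<in> Field Q \<rightarrow> Field P"
      using g by (auto simp: mem_Above_iff)
    show "(g x, g y) \<in> P" if "x \<in> Field Q" "y \<in> Field Q" "(x, y) \<in> Q" for x y
    proof -
      have "S x \<subseteq> S y"
        using partial_order_trans[OF Q that(3)] by (auto simp: S_def)
      then have "g y \<in> Above P (S x)"
        using g[OF that(2)] by (auto simp: mem_Above_iff)
      then show ?thesis
        using least that by blast
    qed
    show "cofinal_in P (g ` Field Q)"
      unfolding cofinal_in_def
    proof (intro conjI ballI)
      show "g ` Field Q \<subseteq> Field P"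
        using closed by auto
      fix p assume p: "p \<in> Field P"
      \<comment> \<open>Beyond this \<open>q\<close> all values of \<open>h\<close> lie above
        \<open>p\<close>, so \<open>p\<close> is one of the lower bounds in \<open>S q\<close> and
        hence below \<open>g q\<close>.\<close>
      obtain q where q: "q \<in> Field Q" "\<And>q'. (q, q') \<in> Q \<Longrightarrow> (p, h q') \<in> P"
        using tukey_ge_obtain_bound[OF P(1) cofinal p] by blast
      then have "p \<in> S q"
        using p by (auto simp: S_def)
      then show "\<exists>y\<in>g ` Field Q. (p, y) \<in> P"
        using g[OF q(1)] q(1) by (auto simp: mem_Above_iff)
    qed
  qed
  then show thesis ..
qed

section \<open>Reverse inclusion and filters\<close>

lemma partial_order_reverse_inclusion: "Partial_order (reverse_inclusion F)"
  unfolding partial_order_on_def preorder_on_def Field_reverse_inclusion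
  by (auto simp: reverse_inclusion_def refl_on_def trans_def antisym_def)

lemma Sigma_Image_singleton: "Sigma S A `` {\<alpha>} = (if \<alpha> \<in> S then A \<alpha> else {})"
  by auto

lemma filter_on_subset: "filter_on X F \<Longrightarrow> A \<in> F \<Longrightarrow> A \<subseteq> X"
  by (auto simp: filter_on_def)

lemma filter_on_top: "filter_on X F \<Longrightarrow> X \<in> F"
  by (simp add: filter_on_def)

lemma filter_on_Int: "filter_on X F \<Longrightarrow> A \<in> F \<Longrightarrow> B \<in> F \<Longrightarrow> A \<inter> B \<in> F"
  by (simp add: filter_on_def)

lemma filter_on_mono: "filter_on X F \<Longrightarrow> A \<in> F \<Longrightarrow> A \<subseteq> B \<Longrightarrow> B \<subseteq> X \<Longrightarrow> B \<in> F"
  by (simp add: filter_on_def)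

lemma filter_on_empty: "filter_on X F \<Longrightarrow> {} \<notin> F"
  by (simp add: filter_on_def)

section \<open>The sum ultrafilter and coherent sequences\<close>

context
  fixes l :: "'a rel" and d :: "'a \<Rightarrow> 'b rel"
    and U :: "'a set set" and V :: "'a \<Rightarrow> 'b set set"
  assumes U: "filter_on (Field l) U"
    and V: "\<And>\<alpha>. \<alpha> \<in> Field l \<Longrightarrow> filter_on (Field (d \<alpha>)) (V \<alpha>)"
begin

text \<open>Outside \<open>S\<close> the sections are empty, and a proper filter omits the empty
  set. Hence the index set \<open>S\<close> can be recovered exactly from
  \<open>Sigma S A\<close>.\<close>

lemma sections_of_Sigma:
  assumes "S \<subseteq> Field l" "\<And>\<alpha>. \<alpha> \<in> S \<Longrightarrow> A \<alpha> \<in> V \<alpha>"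
  shows "{\<alpha> \<in> Field l. Sigma S A `` {\<alpha>} \<in> V \<alpha>} = S"
  using assms filter_on_empty[OF V] by (auto simp: Sigma_Image_singleton)

lemma Sigma_in_sum_ultrafilter:
  assumes "S \<in> U" "\<And>\<alpha>. \<alpha> \<in> S \<Longrightarrow> A \<alpha> \<in> V \<alpha>"
  shows "Sigma S A \<in> sum_ultrafilter l d U V"
proof -
  have S: "S \<subseteq> Field l"
    by (rule filter_on_subset[OF U assms(1)])
  then have "Sigma S A \<subseteq> (SIGMA \<alpha>:Field l. Field (d \<alpha>))"
    using assms(2) filter_on_subset[OF V] by fastforce
  then show ?thesis
    using sections_of_Sigma[OF S assms(2)] assms(1) by (simp add: sum_ultrafilter_def)
qed

text \<open>Intersecting with \<open>X\<close> stays in \<open>U\<close> and keeps \<open>A\<close>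
  from being evaluated outside its domain. Shrinking \<open>Z\<close>, the sets
  \<open>A \<alpha>\<close> or the index set shrinks the Sigma set and so raises the value of
  \<open>g\<close>: the first two give monotonicity, the third coherence.\<close>

lemma coherent_sequence_if_sum_map:
  assumes P: "Partial_order P"
    and g: "monotone_cofinal_map (reverse_inclusion (sum_ultrafilter l d U V)) P g"
  shows "coherent_sequence U V P (\<lambda>X (Z, A). g (Sigma (Z \<inter> X) A))"
proof -
  let ?W = "sum_ultrafilter l d U V"
  have closed: "g B \<in> Field P" if "B \<in> ?W" for B
    using monotone_cofinal_mapD(1)[OF g] that by simp
  have mono: "(g B, g B') \<in> P" if "B \<in> ?W" "B' \<in> ?W" "B' \<subseteq> B" for B B'
    using monotone_cofinal_mapD(2)[OF g] that by (simp add: reverse_inclusion_def)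
  have mem: "Sigma (Z \<inter> X) A \<in> ?W" if "Z \<in> U" "X \<in> U" "A \<in> Pi\<^sub>E X V" for Z X A
    using that by (intro Sigma_in_sum_ultrafilter filter_on_Int[OF U]) auto
  have cofinal: "\<exists>Z\<in>U. \<exists>A\<in>Pi\<^sub>E X V. (p, g (Sigma (Z \<inter> X) A)) \<in> P"
    if X: "X \<in> U" and "p \<in> Field P" for X p
  proof -
    obtain B where B: "B \<in> ?W" "(p, g B) \<in> P"
      using monotone_cofinal_mapD(3)[OF g \<open>p \<in> Field P\<close>] by auto
    \<comment> \<open>\<open>Z\<close> collects the indices of the large sections of
      \<open>B\<close>. Since \<open>A\<close> must have a value in \<open>V \<alpha>\<close> for
      every \<alpha> in \<open>X\<close>, the full carrier is the default off \<open>Z\<close>; it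
      never enters \<open>Sigma (Z \<inter> X) A\<close>, which therefore lies inside
      \<open>B\<close>.\<close>
    define Z where "Z = {\<alpha> \<in> Field l. B `` {\<alpha>} \<in> V \<alpha>}"
    define A where "A = (\<lambda>\<alpha>\<in>X. if \<alpha> \<in> Z then B `` {\<alpha>} else Field (d \<alpha>))"
    have Z: "Z \<in> U"
      using B by (simp add: Z_def sum_ultrafilter_def)
    have A: "A \<in> Pi\<^sub>E X V"
      using filter_on_top[OF V] filter_on_subset[OF U X] by (auto simp: A_def Z_def)
    have "Sigma (Z \<inter> X) A \<subseteq> B"
      by (auto simp: A_def)
    then have "(p, g (Sigma (Z \<inter> X) A)) \<in> P"
      using partial_order_trans[OF P B(2)] mono[OF B(1) mem[OF Z X A]] by blast
    then show ?thesis
      using Z A by blast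
  qed
  show ?thesis
    unfolding coherent_sequence_def
  proof (intro conjI ballI impI)
    fix X assume X: "X \<in> U"
    show "monotone_cofinal_map (prod_order U V X) P (\<lambda>(Z, A). g (Sigma (Z \<inter> X) A))"
      unfolding monotone_cofinal_map_def
    proof (intro conjI monotone_onI)
      show f: "(\<lambda>(Z, A). g (Sigma (Z \<inter> X) A)) \<in> Field (prod_order U V X) \<rightarrow> Field P"
        using closed mem X by auto
      show "cofinal_in P ((\<lambda>(Z, A). g (Sigma (Z \<inter> X) A)) ` Field (prod_order U V X))"
        unfolding cofinal_in_def
      proof (intro conjI ballI)
        show "(\<lambda>(Z, A). g (Sigma (Z \<inter> X) A)) ` Field (prod_order U V X) \<subseteq> Field P"
          using f by (simp add: image_subset_iff_funcset)
        fix p assume "p \<in> Field P"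
        then obtain Z A where "Z \<in> U" "A \<in> Pi\<^sub>E X V" "(p, g (Sigma (Z \<inter> X) A)) \<in> P"
          using cofinal[OF X] by blast
        then show "\<exists>y\<in>(\<lambda>(Z, A). g (Sigma (Z \<inter> X) A)) ` Field (prod_order U V X). (p, y) \<in> P"
          by (intro bexI[of _ "g (Sigma (Z \<inter> X) A)"] image_eqI[of _ _ "(Z, A)"]) simp_all
      qed
    next
      fix C C' assume "(C, C') \<in> prod_order U V X"
      then obtain Z A Z' A' where C: "C = (Z, A)" "C' = (Z', A')" "Z \<in> U" "Z' \<in> U"
        "A \<in> Pi\<^sub>E X V" "A' \<in> Pi\<^sub>E X V" "Z' \<subseteq> Z" "\<And>\<alpha>. \<alpha> \<in> X \<Longrightarrow> A' \<alpha> \<subseteq> A \<alpha>"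
        by (auto simp: prod_order_def)
      then have "Sigma (Z' \<inter> X) A' \<subseteq> Sigma (Z \<inter> X) A"
        by blast
      then show "((case C of (Z, A) \<Rightarrow> g (Sigma (Z \<inter> X) A)),
          (case C' of (Z, A) \<Rightarrow> g (Sigma (Z \<inter> X) A))) \<in> P"
        using C mono mem X by simp
    qed
  next
    fix X Y C assume X: "X \<in> U" and Y: "Y \<in> U" and "Y \<subseteq> X"
      and "C \<in> Field (prod_order U V X)"
    then obtain Z A where C: "C = (Z, A)" "Z \<in> U" "A \<in> Pi\<^sub>E X V"
      by auto
    then have "restrict A Y \<in> Pi\<^sub>E Y V"
      using \<open>Y \<subseteq> X\<close> by auto
    moreover have "Sigma (Z \<inter> Y) (restrict A Y) \<subseteq> Sigma (Z \<inter> X) A"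
      using \<open>Y \<subseteq> X\<close> by auto
    ultimately show "((case C of (Z, A) \<Rightarrow> g (Sigma (Z \<inter> X) A)),
        (case prod_proj Y C of (Z, A) \<Rightarrow> g (Sigma (Z \<inter> Y) A))) \<in> P"
      using C mono[OF mem[OF C(2) X C(3)] mem[OF C(2) Y]] by (simp add: prod_proj_def)
  qed
qed

text \<open>Passing from \<open>B\<close> to a smaller \<open>B'\<close> changes both the index set
  and the point. Coherence handles the change of index set from \<open>X B\<close> to
  \<open>X B'\<close>, and monotonicity of \<open>f (X B')\<close> then handles the change of
  point.\<close>

lemma sum_map_if_coherent_sequence:
  assumes P: "Partial_order P" and f: "coherent_sequence U V P f"
  obtains g where "monotone_cofinal_map (reverse_inclusion (sum_ultrafilter l d U V)) P g"
proof
  let ?W = "sum_ultrafilter l d U V"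
  define X where "X B = {\<alpha> \<in> Field l. B `` {\<alpha>} \<in> V \<alpha>}" for B :: "('a \<times> 'b) set"
  define G where "G B = f (X B) (X B, \<lambda>\<alpha>\<in>X B. B `` {\<alpha>})" for B
  have closed: "f Y (Z, A) \<in> Field P" if "Y \<in> U" "Z \<in> U" "A \<in> Pi\<^sub>E Y V" for Y Z A
    using monotone_cofinal_mapD(1)[OF coherent_sequenceD(1)[OF f]] that by simp
  have mono: "(f Y (Z, A), f Y (Z', A')) \<in> P"
    if "Y \<in> U" "((Z, A), (Z', A')) \<in> prod_order U V Y" for Y Z A Z' A'
    by (rule monotone_cofinal_mapD(2)[OF coherent_sequenceD(1)[OF f] that(2)]) (rule that(1))
  have coherent: "(f Y (Z, A), f Y' (Z, restrict A Y')) \<in> P"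
    if "Y \<in> U" "Y' \<in> U" "Y' \<subseteq> Y" "Z \<in> U" "A \<in> Pi\<^sub>E Y V" for Y Y' Z A
    using coherent_sequenceD(2)[OF f that(1-3), of "(Z, A)"] that(4,5) by (simp add: prod_proj_def)
  have X: "X B \<in> U" if "B \<in> ?W" for B
    using that by (simp add: X_def sum_ultrafilter_def)
  have sections: "(\<lambda>\<alpha>\<in>X B. B `` {\<alpha>}) \<in> Pi\<^sub>E (X B) V" for B
    by (auto simp: X_def)
  show "monotone_cofinal_map (reverse_inclusion ?W) P G"
    unfolding monotone_cofinal_map_def
  proof (intro conjI monotone_onI)
    show G: "G \<in> Field (reverse_inclusion ?W) \<rightarrow> Field P"
      using closed X sections by (auto simp: G_def)
    fix B B' assume "(B, B') \<in> reverse_inclusion ?W"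
    then have B: "B \<in> ?W" "B' \<in> ?W" "B' \<subseteq> B"
      by (auto simp: reverse_inclusion_def)
    have sub: "X B' \<subseteq> X B"
    proof
      fix \<alpha> assume \<alpha>: "\<alpha> \<in> X B'"
      \<comment> \<open>Upward closure of \<open>V \<alpha>\<close> holds only within the carrier,
        so the larger section has to be placed there first.\<close>
      have "B `` {\<alpha>} \<subseteq> Field (d \<alpha>)"
        using B(1) by (auto simp: sum_ultrafilter_def)
      then show "\<alpha> \<in> X B"
        using \<alpha> filter_on_mono[OF V, of \<alpha> "B' `` {\<alpha>}" "B `` {\<alpha>}"] B(3) by (auto simp: X_def)
    qed
    \<comment> \<open>The intermediate point is \<open>(X B, ?A)\<close>, the projection to
      \<open>X B'\<close> of the point used for \<open>B\<close>: the first coordinate is still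
      \<open>X B\<close>. The nested restriction is kept because this is the form in which
      \<open>coherent\<close> yields it.\<close>
    let ?A = "restrict (\<lambda>\<alpha>\<in>X B. B `` {\<alpha>}) (X B')"
    have "?A \<in> Pi\<^sub>E (X B') V"
      using sub sections[of B]
      by (simp add: restrict_PiE_iff PiE_iff subset_iff del: restrict_restrict)
    moreover have "\<And>\<alpha>. \<alpha> \<in> X B' \<Longrightarrow> B' `` {\<alpha>} \<subseteq> ?A \<alpha>"
      using sub B(3) by auto
    ultimately have "((X B, ?A), (X B', \<lambda>\<alpha>\<in>X B'. B' `` {\<alpha>})) \<in> prod_order U V (X B')"
      using sub sections[of B'] X[OF B(1)] X[OF B(2)]
      by (simp add: prod_order_def del: restrict_restrict)
    then show "(G B, G B') \<in> P"
      unfolding G_def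
      by (rule partial_order_trans[OF P coherent mono, OF X[OF B(1)] X[OF B(2)] sub X[OF B(1)]
            sections X[OF B(2)]])
  next
    show "cofinal_in P (G ` Field (reverse_inclusion ?W))"
      unfolding cofinal_in_def
    proof (intro conjI ballI)
      show "G ` Field (reverse_inclusion ?W) \<subseteq> Field P"
        using closed X sections by (auto simp: G_def)
      fix p assume "p \<in> Field P"
      \<comment> \<open>A suitable index set for \<open>p\<close> is not known in advance.
        Cofinality at the full index set first produces \<open>Z\<close>, and coherence then moves
        down to \<open>Z\<close> without losing the bound \<open>p\<close>. As \<open>Z\<close> is
        exactly the index set of \<open>Sigma Z A\<close>, the value reached there is
        \<open>G (Sigma Z A)\<close>.\<close>
      have top: "Field l \<in> U"
        by (rule filter_on_top[OF U])
      obtain Z A where ZA: "Z \<in> U" "A \<in> Pi\<^sub>E (Field l) V" "(p, f (Field l) (Z, A)) \<in> P"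
        using monotone_cofinal_mapD(3)[OF coherent_sequenceD(1)[OF f top] \<open>p \<in> Field P\<close>] by auto
      have Z: "Z \<subseteq> Field l"
        by (rule filter_on_subset[OF U ZA(1)])
      have AV: "\<And>\<alpha>. \<alpha> \<in> Z \<Longrightarrow> A \<alpha> \<in> V \<alpha>"
        using Z ZA(2) by auto
      have W: "Sigma Z A \<in> ?W"
        by (rule Sigma_in_sum_ultrafilter[OF ZA(1) AV])
      have "X (Sigma Z A) = Z"
        unfolding X_def by (rule sections_of_Sigma[OF Z AV])
      moreover have "(\<lambda>\<alpha>\<in>Z. Sigma Z A `` {\<alpha>}) = restrict A Z"
        by (rule restrict_ext) (simp add: Sigma_Image_singleton)
      ultimately have "G (Sigma Z A) = f Z (Z, restrict A Z)"
        by (simp only: G_def)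
      then have "(p, G (Sigma Z A)) \<in> P"
        using partial_order_trans[OF P ZA(3) coherent[OF top ZA(1) Z ZA(1,2)]] by simp
      then show "\<exists>y\<in>G ` Field (reverse_inclusion ?W). (p, y) \<in> P"
        using W by auto
    qed
  qed
qed

end

theorem theorem2p12:
  fixes l :: "'a rel" and d :: "'a \<Rightarrow> 'b rel"
    and U :: "'a set set" and V :: "'a \<Rightarrow> 'b set set"
    and P :: "'p rel"
  assumes "infinite_regular_cardinal l"
    and "uniform_complete_ultrafilter l U"
    and "\<And>\<alpha>. \<alpha> \<in> Field l \<Longrightarrow> infinite_regular_cardinal (d \<alpha>)"
    and "\<And>\<alpha>. \<alpha> \<in> Field l \<Longrightarrow> uniform_complete_ultrafilter (d \<alpha>) (V \<alpha>)"
    and "Partial_order P"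
    and "complete_order P"
  shows "uniformly_below P U V \<longleftrightarrow>
    tukey_ge (reverse_inclusion (sum_ultrafilter l d U V)) P"
proof -
  have U: "filter_on (Field l) U"
    using assms(2) by (simp add: uniform_complete_ultrafilter_def ultrafilter_on_def)
  have V: "filter_on (Field (d \<alpha>)) (V \<alpha>)" if "\<alpha> \<in> Field l" for \<alpha>
    using assms(4)[OF that] by (simp add: uniform_complete_ultrafilter_def ultrafilter_on_def)
  show ?thesis
  proof
    assume "uniformly_below P U V"
    then obtain f where "coherent_sequence U V P f"
      by (auto simp: uniformly_below_def)
    from sum_map_if_coherent_sequence[OF U V assms(5) this]
    obtain g where "monotone_cofinal_map (reverse_inclusion (sum_ultrafilter l d U V)) P g" .
    then show "tukey_ge (reverse_inclusion (sum_ultrafilter l d U V)) P"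
      by (rule tukey_ge_if_monotone_cofinal_map[OF assms(5)])
  next
    assume "tukey_ge (reverse_inclusion (sum_ultrafilter l d U V)) P"
    from monotone_cofinal_map_if_tukey_ge[OF partial_order_reverse_inclusion assms(5,6) this]
    obtain g where "monotone_cofinal_map (reverse_inclusion (sum_ultrafilter l d U V)) P g" .
    then show "uniformly_below P U V"
      unfolding uniformly_below_def
      by (intro exI) (rule coherent_sequence_if_sum_map[OF U V assms(5)])
  qed
qed

end
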